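(* Let $A \subset \mathbb{C}$, let $F : A \to A$ be a map (not necessarily rational), and let $\mathcal{F} \subseteq A$ be the set of all $z_0 \in A$ for which the sequence $\{z_n\}_{n\ge 0}$ defined by $z_{n+1} = F(z_n)$ is bounded. Let $f : A \to \mathbb{C}$ be a bi-Lipschitz function, i.e. there exist numbers $l_1, l_2 > 0$ such that $$l_1 |u-v| \leq |f(u)-f(v)| \leq l_2 |u-v| \quad \text{for all } u, v \in A.$$ Let $\mathcal{F}_f$ be the set of all $z_0 \in f(A)$ for which the sequence $\{z_n\}_{n\ge 0}$ defined by $z_{n+1} = f\big(F(f^{-1}(z_n))\big)$ is bounded. Then $\mathcal{F}_f = f(\mathcal{F})$.
   Context: Here $\mathbb{C}$ is the set of complex numbers. The iteration $z_{n+1}=F(z_n)$ is called the Fatou-Julia iteration (FJI), and the set $\mathcal{F}$ constructed by it consists of the points $z_0\in A$ whose iteration sequence is bounded. Given a one-to-one map $f$ on $A$, with inverse $f^{-1}: f(A)\to A$, the iteration $f^{-1}(z_{n+1})=F\big(f^{-1}(z_n)\big)$, equivalently $z_{n+1}=f\big(F(f^{-1}(z_n))\big)$, with $z_0\in f(A)$, is called the Fractals Mapping Iteration (FMI), and $\mathcal{F}_f$ is the set of points $z_0\in f(A)$ whose FMI sequence is bounded. (A bi-Lipschitz $f$ is automatically one-to-one.) *)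

theory Defs
  imports "HOL-Analysis.Analysis"
begin

definition bi_lipschitz_on :: "complex set \<Rightarrow> (complex \<Rightarrow> complex) \<Rightarrow> bool" where
  "bi_lipschitz_on A f \<longleftrightarrow>
     (\<exists>l1>0. \<exists>l2>0. \<forall>u\<in>A. \<forall>v\<in>A.
        l1 * cmod (u - v) \<le> cmod (f u - f v) \<and> cmod (f u - f v) \<le> l2 * cmod (u - v))"

definition bounded_orbit_points :: "complex set \<Rightarrow> (complex \<Rightarrow> complex) \<Rightarrow> complex set" where
  "bounded_orbit_points A F = {z0 \<in> A. bounded (range (\<lambda>n. (F ^^ n) z0))}"

definition FJI_set :: "complex set \<Rightarrow> (complex \<Rightarrow> complex) \<Rightarrow> complex set" where
  "FJI_set A F = bounded_orbit_points A F"

text \<open>A map given on \<open>A\<close> is a total function whose values outside \<open>A\<close> play no role, so the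
  inverse \<open>f (A) \<rightarrow> A\<close> is \<open>inv_into A f\<close>. It is the inverse of \<open>f\<close> only when \<open>f\<close> is injective
  on \<open>A\<close>.\<close>

definition FMI_step :: "complex set \<Rightarrow> (complex \<Rightarrow> complex) \<Rightarrow> (complex \<Rightarrow> complex) \<Rightarrow> complex \<Rightarrow> complex" where
  "FMI_step A F f z = f (F (inv_into A f z))"

definition FMI_set :: "complex set \<Rightarrow> (complex \<Rightarrow> complex) \<Rightarrow> (complex \<Rightarrow> complex) \<Rightarrow> complex set" where
  "FMI_set A F f = bounded_orbit_points (f ` A) (FMI_step A F f)"

end

theory Submission
  imports Defs
begin

text \<open>The map \<open>f\<close> conjugates \<open>F\<close> on \<open>A\<close> to the FMI step
  on the image of \<open>A\<close>: the lower Lipschitz bound makes \<open>f\<close> injective, so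
  the inverse cancels \<open>f\<close> along orbits, and the FMI orbit of \<open>f z\<close> is the
  image under \<open>f\<close> of the FJI orbit of \<open>z\<close>
  (\<open>FMI_step_funpow\<close>). A bi-Lipschitz map preserves boundedness in both directions
  (\<open>bi_lipschitz_on_bounded_image_iff\<close>), so one orbit is bounded exactly when the other
  is.\<close>

lemma bi_lipschitz_on_imp_inj_on:
  assumes "bi_lipschitz_on A f"
  shows "inj_on f A"
proof (rule inj_onI)
  fix u v assume uv: "u \<in> A" "v \<in> A" "f u = f v"
  obtain l where "l > 0" "\<forall>u\<in>A. \<forall>v\<in>A. l * cmod (u - v) \<le> cmod (f u - f v)"
    using assms unfolding bi_lipschitz_on_def by blast
  with uv have "l * cmod (u - v) \<le> 0" by fastforce
  with \<open>l > 0\<close> show "u = v" by (simp add: mult_le_0_iff)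
qed

text \<open>Diameters of \<open>S\<close> and its image control each other up to the factors
  \<open>l1\<close> and \<open>l2\<close>. Boundedness is used in its two-point form because the
  Lipschitz bounds concern differences only; no base point is needed, and \<open>S\<close> may be
  empty.\<close>

lemma bi_lipschitz_on_bounded_image_iff:
  assumes "bi_lipschitz_on A f" "S \<subseteq> A"
  shows "bounded (f ` S) \<longleftrightarrow> bounded S"
proof -
  obtain l1 l2 where l: "l1 > 0" "l2 > 0"
    and lip: "\<forall>u\<in>A. \<forall>v\<in>A. l1 * cmod (u - v) \<le> cmod (f u - f v)
                \<and> cmod (f u - f v) \<le> l2 * cmod (u - v)"
    using assms(1) unfolding bi_lipschitz_on_def by blast
  show ?thesis
  proof
    assume "bounded (f ` S)"
    then obtain e where e: "\<forall>x\<in>f ` S. \<forall>y\<in>f ` S. dist x y \<le> e"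
      unfolding bounded_two_points by blast
    have "dist u v \<le> e / l1" if "u \<in> S" "v \<in> S" for u v
    proof -
      have "l1 * cmod (u - v) \<le> cmod (f u - f v)" using lip that assms(2) by blast
      also have "\<dots> \<le> e" using e that by (simp add: dist_norm)
      finally show ?thesis using l by (simp add: dist_norm field_simps)
    qed
    then show "bounded S" unfolding bounded_two_points by blast
  next
    assume "bounded S"
    then obtain e where e: "\<forall>x\<in>S. \<forall>y\<in>S. dist x y \<le> e"
      unfolding bounded_two_points by blast
    have "dist (f u) (f v) \<le> l2 * e" if "u \<in> S" "v \<in> S" for u v
    proof -
      have "cmod (f u - f v) \<le> l2 * cmod (u - v)" using lip that assms(2) by blast
      also have "\<dots> \<le> l2 * e" using e that l by (simp add: dist_norm)
      finally show ?thesis by (simp add: dist_norm)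
    qed
    then show "bounded (f ` S)" unfolding bounded_two_points by blast
  qed
qed

lemma funpow_in_invariant:
  assumes "F ` A \<subseteq> A" "z \<in> A"
  shows "(F ^^ n) z \<in> A"
  using assms by (induction n) auto

text \<open>In the induction step \<open>inv_into A f\<close> undoes \<open>f\<close> at the current
  orbit point; this is legitimate because the orbit never leaves \<open>A\<close>, where
  \<open>f\<close> is injective.\<close>

lemma FMI_step_funpow:
  assumes "F ` A \<subseteq> A" "inj_on f A" "z \<in> A"
  shows "(FMI_step A F f ^^ n) (f z) = f ((F ^^ n) z)"
proof (induction n)
  case (Suc n)
  then show ?case
    using funpow_in_invariant[OF assms(1,3), of n] assms(2) by (simp add: FMI_step_def)
qed simp

theorem theorem1:
  fixes A :: "complex set" and F f :: "complex \<Rightarrow> complex"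
  assumes "F ` A \<subseteq> A"
    and "bi_lipschitz_on A f"
  shows "FMI_set A F f = f ` FJI_set A F"
proof -
  have "bounded (range (\<lambda>n. (FMI_step A F f ^^ n) (f z)))
      \<longleftrightarrow> bounded (range (\<lambda>n. (F ^^ n) z))" if "z \<in> A" for z
  proof -
    have "range (\<lambda>n. (FMI_step A F f ^^ n) (f z)) = f ` range (\<lambda>n. (F ^^ n) z)"
      using FMI_step_funpow[OF assms(1) bi_lipschitz_on_imp_inj_on[OF assms(2)] that]
      by (simp add: image_image)
    moreover have "range (\<lambda>n. (F ^^ n) z) \<subseteq> A"
      using funpow_in_invariant[OF assms(1) that] by blast
    ultimately show ?thesis
      using bi_lipschitz_on_bounded_image_iff[OF assms(2)] by simp
  qed
  \<comment> \<open>Every point of the image of \<open>A\<close> is \<open>f z\<close> for some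
    \<open>z\<close> in \<open>A\<close>, so the equivalence for each \<open>z\<close> yields both
    inclusions.\<close>
  then show ?thesis
    unfolding FMI_set_def FJI_set_def bounded_orbit_points_def by blast
qed

end
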